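(* Let $F_n$ be the free group on $x_1,\ldots,x_n$. For each word $w\in F_n$ of one of the following types there exists an automorphism $\sigma$ of $F_n$ with $\sigma(w)=w^{-1}$, and $w$ is achiral: 1. $w$ is a palindromic word; 2. ($n\ge 2$) $w=x_1^{m_1}x_2^{m_2}$, where $m_1,m_2\in\mathbb{Z}$; 3. ($n\ge 2$) $w=x_1^{m}x_2^{\epsilon_1}x_1^{k}x_2^{\epsilon_2}$, where $m,k,\epsilon_1,\epsilon_2\in\mathbb{Z}$ and $\epsilon_1=\pm\epsilon_2$.
   Context: For $w\in F_n$ and a group $G$, the word map of $w$ on $G$ is the map $G^n\to G$, $(g_1,\ldots,g_n)\mapsto w(g_1,\ldots,g_n)$, obtained by substituting $g_i$ for $x_i$ in $w$; its image is denoted $G_w$. A word $w\in F_n$ is achiral if $G_w=G_{w^{-1}}$ for every group $G$. A palindromic word is a reduced word which, written as a sequence of letters from $\{x_1^{\pm1},\ldots,x_n^{\pm1}\}$, reads the same forwards and backwards. *)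

theory Defs
  imports "HOL-Algebra.Bij"
begin

text \<open>The free group \<open>F\<^sub>n\<close> is built on the reduced words over the letters
  \<open>x\<^sub>i\<close> and \<open>x\<^sub>i\<inverse>\<close>, \<open>1 \<le> i \<le> n\<close>.\<close>

type_synonym letter = "nat \<times> bool" \<comment> \<open>\<open>(i, True)\<close> is \<open>x\<^sub>i\<close>, \<open>(i, False)\<close> is \<open>x\<^sub>i\<inverse>\<close>\<close>
type_synonym word = "letter list"

definition letter_inv :: "letter \<Rightarrow> letter" where
  "letter_inv a = (fst a, \<not> snd a)"

definition reduced :: "word \<Rightarrow> bool" where
  "reduced w \<longleftrightarrow> successively (\<lambda>a b. b \<noteq> letter_inv a) w"

text \<open>Left multiplication of a reduced word by a single letter, cancelling at the junction.\<close>

fun push :: "letter \<Rightarrow> word \<Rightarrow> word" where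
  "push a [] = [a]"
| "push a (b # v) = (if b = letter_inv a then v else a # b # v)"

definition free_group :: "nat \<Rightarrow> word monoid" where
  "free_group n =
    \<lparr>carrier = {w. reduced w \<and> fst ` set w \<subseteq> {1..n}},
     mult = (\<lambda>u v. foldr push u v),
     one = []\<rparr>"

definition gen :: "nat \<Rightarrow> word" where
  "gen i = [(i, True)]"

definition palindromic :: "word \<Rightarrow> bool" where
  "palindromic w \<longleftrightarrow> reduced w \<and> rev w = w"

definition word_eval :: "('g, 'm) monoid_scheme \<Rightarrow> (nat \<Rightarrow> 'g) \<Rightarrow> word \<Rightarrow> 'g" where
  "word_eval G g w =
     foldr (\<lambda>(i, b) y. (if b then g i else inv\<^bsub>G\<^esub> (g i)) \<otimes>\<^bsub>G\<^esub> y) w \<one>\<^bsub>G\<^esub>"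

definition word_image :: "('g, 'm) monoid_scheme \<Rightarrow> nat \<Rightarrow> word \<Rightarrow> 'g set" where
  "word_image G n w = (\<lambda>g. word_eval G g w) ` ({1..n} \<rightarrow>\<^sub>E carrier G)"

text \<open>A definition cannot quantify over types, so the carrier type \<open>'g\<close> of the groups is a
  parameter. Achirality in the usual sense is \<open>achiral TYPE('g) n w\<close> for every type \<open>'g\<close>,
  expressed by leaving \<open>'g\<close> a free type variable of a theorem.\<close>

definition achiral :: "'g itself \<Rightarrow> nat \<Rightarrow> word \<Rightarrow> bool" where
  "achiral _ n w \<longleftrightarrow>
     (\<forall>G :: 'g monoid. group G \<longrightarrow>
        word_image G n w = word_image G n (inv\<^bsub>free_group n\<^esub> w))"


lemma letter_inv_invol [simp]: "letter_inv (letter_inv a) = a"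
  by (simp add: letter_inv_def)

lemma letter_inv_neq [simp]: "letter_inv a \<noteq> a" "a \<noteq> letter_inv a"
  by (metis letter_inv_def snd_conv)+

lemma fst_letter_inv [simp]: "fst (letter_inv a) = fst a"
  by (simp add: letter_inv_def)

lemma reduced_Nil [simp]: "reduced []"
  by (simp add: reduced_def)

lemma reduced_Cons:
  "reduced (a # w) \<longleftrightarrow> reduced w \<and> (w \<noteq> [] \<longrightarrow> hd w \<noteq> letter_inv a)"
  by (cases w) (auto simp: reduced_def)

lemma reduced_push: "reduced w \<Longrightarrow> reduced (push a w)"
  by (cases w) (auto simp: reduced_Cons)

lemma set_push: "set (push a w) \<subseteq> insert a (set w)"
  by (cases w) auto

lemma push_letter_inv:
  assumes "reduced w"
  shows "push a (push (letter_inv a) w) = w"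
proof (cases w)
  case (Cons b v)
  show ?thesis
  proof (cases "b = a")
    case True
    then show ?thesis
      using assms Cons by (cases v) (auto simp: reduced_Cons)
  next
    case False
    then show ?thesis using Cons by simp
  qed
qed simp

lemma push_reduced: "reduced (a # w) \<Longrightarrow> push a w = a # w"
  by (cases w) (auto simp: reduced_Cons)

lemma reduced_foldr_push: "reduced v \<Longrightarrow> reduced (foldr push u v)"
  by (induction u) (auto intro: reduced_push)

lemma set_foldr_push: "set (foldr push u v) \<subseteq> set u \<union> set v"
proof (induction u)
  case (Cons a u)
  then show ?case using set_push[of a "foldr push u v"] by auto
qed simp

lemma foldr_push_push:
  assumes "reduced v"
  shows "foldr push (push a u) v = push a (foldr push u v)"
proof (cases u)
  case (Cons b u')
  then show ?thesis
    using push_letter_inv[OF reduced_foldr_push[OF assms]] by simp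
qed simp

lemma foldr_push_assoc:
  assumes "reduced w"
  shows "foldr push (foldr push u v) w = foldr push u (foldr push v w)"
  by (induction u) (simp_all add: foldr_push_push[OF assms])

lemma foldr_push_Nil: "reduced u \<Longrightarrow> foldr push u [] = u"
  by (induction u) (simp_all add: reduced_Cons push_reduced)

lemma foldr_push_inverse: "foldr push (rev (map letter_inv u)) u = []"
  by (induction u) auto

lemma reduced_inverse:
  assumes "reduced u"
  shows "reduced (rev (map letter_inv u))"
proof -
  have "successively (\<lambda>a b. letter_inv a \<noteq> b) u"
    using assms unfolding reduced_def by (rule successively_mono) simp
  then show ?thesis
    unfolding reduced_def successively_rev successively_map by simp
qed

lemma group_free_group: "group (free_group n)"
proof (rule groupI)
  fix u v
  assume "u \<in> carrier (free_group n)" "v \<in> carrier (free_group n)"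
  then show "u \<otimes>\<^bsub>free_group n\<^esub> v \<in> carrier (free_group n)"
    using set_foldr_push[of u v] by (fastforce simp: free_group_def reduced_foldr_push)
next
  fix u
  assume u: "u \<in> carrier (free_group n)"
  show "\<exists>v\<in>carrier (free_group n). v \<otimes>\<^bsub>free_group n\<^esub> u = \<one>\<^bsub>free_group n\<^esub>"
  proof
    show "rev (map letter_inv u) \<otimes>\<^bsub>free_group n\<^esub> u = \<one>\<^bsub>free_group n\<^esub>"
      by (simp add: free_group_def foldr_push_inverse)
    show "rev (map letter_inv u) \<in> carrier (free_group n)"
      using u reduced_inverse[of u] by (auto simp: free_group_def)
  qed
qed (auto simp: free_group_def foldr_push_assoc)

lemma inv_free_group:
  assumes "u \<in> carrier (free_group n)"
  shows "inv\<^bsub>free_group n\<^esub> u = rev (map letter_inv u)"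
proof -
  interpret group "free_group n" by (rule group_free_group)
  show ?thesis
  proof (rule inv_equality)
    show "rev (map letter_inv u) \<otimes>\<^bsub>free_group n\<^esub> u = \<one>\<^bsub>free_group n\<^esub>"
      by (simp add: free_group_def foldr_push_inverse)
    show "rev (map letter_inv u) \<in> carrier (free_group n)"
      using assms reduced_inverse[of u] by (auto simp: free_group_def)
  qed (fact assms)
qed

lemma gen_in_carrier: "i \<in> {1..n} \<Longrightarrow> gen i \<in> carrier (free_group n)"
  by (simp add: gen_def free_group_def reduced_Cons)

text \<open>Evaluation is the homomorphism given by the universal property of \<open>F\<^sub>n\<close>.\<close>

lemma word_eval_closed:
  assumes "group G" "g \<in> {1..n} \<rightarrow> carrier G" "fst ` set w \<subseteq> {1..n}"
  shows "word_eval G g w \<in> carrier G"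
proof -
  interpret group G by fact
  show ?thesis using assms(3)
  proof (induction w)
    case (Cons a w)
    have "g (fst a) \<in> carrier G" using Cons.prems assms(2) by auto
    then show ?case using Cons by (cases a) (auto simp: word_eval_def)
  qed (simp add: word_eval_def)
qed

lemma word_eval_push:
  assumes "group G" "g \<in> {1..n} \<rightarrow> carrier G" "fst ` set (a # w) \<subseteq> {1..n}"
  shows "word_eval G g (push a w) = word_eval G g (a # w)"
proof (cases w)
  case (Cons b v)
  interpret group G by fact
  have g: "g (fst a) \<in> carrier G" using assms(2,3) by auto
  have v: "word_eval G g v \<in> carrier G"
    using word_eval_closed[OF assms(1,2)] assms(3) Cons by auto
  show ?thesis using g v Cons
    by (cases a; cases "snd a")
      (auto simp: word_eval_def letter_inv_def m_assoc[symmetric])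
qed simp

lemma word_eval_hom:
  assumes "group G" "g \<in> {1..n} \<rightarrow> carrier G"
  shows "word_eval G g \<in> hom (free_group n) G"
proof (rule homI)
  interpret group G by fact
  fix u v
  assume "u \<in> carrier (free_group n)" "v \<in> carrier (free_group n)"
  then have uv: "fst ` set u \<subseteq> {1..n}" "fst ` set v \<subseteq> {1..n}"
    by (auto simp: free_group_def)
  have "word_eval G g (foldr push u v) = word_eval G g u \<otimes>\<^bsub>G\<^esub> word_eval G g v"
    using uv(1)
  proof (induction u)
    case Nil
    then show ?case using word_eval_closed[OF assms uv(2)] by (simp add: word_eval_def)
  next
    case (Cons a u)
    have g: "g (fst a) \<in> carrier G" using Cons.prems assms(2) by auto
    have u: "word_eval G g u \<in> carrier G"
      using word_eval_closed[OF assms] Cons.prems by auto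
    have "fst ` set (a # foldr push u v) \<subseteq> {1..n}"
      using Cons.prems uv(2) set_foldr_push[of u v] by fastforce
    then have "word_eval G g (foldr push (a # u) v) = word_eval G g (a # foldr push u v)"
      using word_eval_push[OF assms] by simp
    then show ?case
      using Cons g u word_eval_closed[OF assms uv(2)]
      by (cases a) (auto simp: word_eval_def m_assoc)
  qed
  then show "word_eval G g (u \<otimes>\<^bsub>free_group n\<^esub> v) = word_eval G g u \<otimes>\<^bsub>G\<^esub> word_eval G g v"
    by (simp add: free_group_def)
qed (use word_eval_closed[OF assms] in \<open>simp add: free_group_def\<close>)

lemma word_eval_gen:
  assumes "group G" "g i \<in> carrier G"
  shows "word_eval G g (gen i) = g i"
proof -
  interpret group G by fact
  show ?thesis using assms(2) by (simp add: word_eval_def gen_def)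
qed

end

theory Submission
  imports Defs
begin

text \<open>
  The inverse of a word reverses the order of its letters and inverts each of them. Inverting
  (some of) the letters in place is an automorphism of the free group, so what remains is to undo
  the reversal. A palindrome does not see it at all. For \<open>x\<^sub>1\<^sup>m x\<^sub>2\<^sup>k\<close> and
  \<open>x\<^sub>1\<^sup>m x\<^sub>2\<^sup>e x\<^sub>1\<^sup>k x\<^sub>2\<^sup>e\<close> the reversal of the syllables amounts to a cyclic rotation by one
  syllable, that is, to a conjugation. In \<open>x\<^sub>1\<^sup>m x\<^sub>2\<^sup>e x\<^sub>1\<^sup>k x\<^sub>2\<^sup>-\<^sup>e\<close> the reversal moreover
  exchanges the two syllables in \<open>x\<^sub>2\<close>, which has the effect of inverting \<open>x\<^sub>2\<close>; there only
  \<open>x\<^sub>1\<close> remains to be inverted. Hence in all cases a sign change of generators followed by a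
  conjugation, an automorphism by \<open>sign_change_conj_auto\<close>, carries \<open>w\<close> to its inverse.

  Achirality follows from the existence of such a map, for which any endomorphism \<open>\<sigma>\<close> will do
  (\<open>achiral_if_endomorphism_inverts\<close>): evaluating \<open>\<sigma> u\<close> at a tuple \<open>g\<close> is evaluating \<open>u\<close> at the
  tuple of the values of the \<open>\<sigma> x\<^sub>i\<close> at \<open>g\<close>, so the image of \<open>\<sigma> u\<close> lies in the image of \<open>u\<close>; and
  \<open>\<sigma>\<close> maps \<open>w\<close> to its inverse as well as the inverse of \<open>w\<close> to \<open>w\<close>.
\<close>

section \<open>Homomorphisms out of the free group and word images\<close>

lemma carrier_free_group_iff:
  "w \<in> carrier (free_group n) \<longleftrightarrow> reduced w \<and> fst ` set w \<subseteq> {1..n}"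
  by (simp add: free_group_def)

lemma inv_gen:
  assumes "i \<in> {1..n}"
  shows "inv\<^bsub>free_group n\<^esub> (gen i) = [(i, False)]"
  using inv_free_group[OF gen_in_carrier[OF assms]] by (simp add: gen_def letter_inv_def)

text \<open>The uniqueness part of the universal property: a reduced word is the product of its
  letters, so a homomorphism is determined by its values at the generators.\<close>

lemma hom_eq_word_eval:
  assumes "group G" "\<phi> \<in> hom (free_group n) G" "w \<in> carrier (free_group n)"
  shows "\<phi> w = word_eval G (\<lambda>i. \<phi> (gen i)) w"
proof -
  interpret \<phi>: group_hom "free_group n" G \<phi>
    using assms(1,2) group_free_group by (simp add: group_hom_def group_hom_axioms_def)
  show ?thesis using assms(3)
  proof (induction w)
    case Nil
    show ?case using \<phi>.hom_one by (simp add: free_group_def word_eval_def)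
  next
    case (Cons a w)
    obtain i b where a: "a = (i, b)" by (cases a)
    have i: "i \<in> {1..n}" and w: "w \<in> carrier (free_group n)"
      and red: "reduced (a # w)"
      using Cons.prems by (auto simp: a carrier_free_group_iff reduced_Cons)
    have "[a] = (if b then gen i else inv\<^bsub>free_group n\<^esub> (gen i))"
      using inv_gen[OF i] by (simp add: a gen_def)
    then have letter: "[a] \<in> carrier (free_group n)"
      "\<phi> [a] = (if b then \<phi> (gen i) else inv\<^bsub>G\<^esub> \<phi> (gen i))"
      using gen_in_carrier[OF i] by auto
    have "a # w = [a] \<otimes>\<^bsub>free_group n\<^esub> w"
      using push_reduced[OF red] by (simp add: free_group_def)
    then have "\<phi> (a # w) = \<phi> [a] \<otimes>\<^bsub>G\<^esub> \<phi> w"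
      using \<phi>.hom_mult[OF letter(1) w] by simp
    then show ?case using Cons.IH[OF w] letter(2) by (simp add: a word_eval_def)
  qed
qed

lemma word_eval_cong:
  assumes "\<And>i. i \<in> fst ` set w \<Longrightarrow> g i = h i"
  shows "word_eval G g w = word_eval G h w"
  using assms by (induction w) (auto simp: word_eval_def)

text \<open>Evaluation after an endomorphism is again a homomorphism to \<open>G\<close>, hence evaluation at
  another tuple.\<close>

lemma word_image_endomorphism_subset:
  assumes "group G" "\<sigma> \<in> hom (free_group n) (free_group n)" "w \<in> carrier (free_group n)"
  shows "word_image G n (\<sigma> w) \<subseteq> word_image G n w"
proof
  fix y
  assume "y \<in> word_image G n (\<sigma> w)"
  then obtain g where g: "g \<in> {1..n} \<rightarrow>\<^sub>E carrier G" and y: "y = word_eval G g (\<sigma> w)"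
    by (auto simp: word_image_def)
  have g_hom: "word_eval G g \<in> hom (free_group n) G"
    using word_eval_hom[OF assms(1)] g by blast
  define h where "h = (\<lambda>i\<in>{1..n}. word_eval G g (\<sigma> (gen i)))"
  have h: "h \<in> {1..n} \<rightarrow>\<^sub>E carrier G"
    using g_hom assms(2) gen_in_carrier by (fastforce simp: h_def hom_def)
  have "word_eval G g \<circ> \<sigma> \<in> hom (free_group n) G"
    using hom_compose[OF assms(2) g_hom] .
  then have "y = word_eval G (\<lambda>i. word_eval G g (\<sigma> (gen i))) w"
    using hom_eq_word_eval[OF assms(1) _ assms(3)] y by fastforce
  also have "\<dots> = word_eval G h w"
    using assms(3) by (intro word_eval_cong) (auto simp: h_def carrier_free_group_iff)
  finally show "y \<in> word_image G n w" using h by (auto simp: word_image_def)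
qed

lemma achiral_if_endomorphism_inverts:
  assumes "\<sigma> \<in> hom (free_group n) (free_group n)" "w \<in> carrier (free_group n)"
    and "\<sigma> w = inv\<^bsub>free_group n\<^esub> w"
  shows "achiral TYPE('g) n w"
proof -
  interpret \<sigma>: group_hom "free_group n" "free_group n" \<sigma>
    using assms(1) group_free_group by (simp add: group_hom_def group_hom_axioms_def)
  have "\<sigma> (inv\<^bsub>free_group n\<^esub> w) = w" using assms(2,3) by simp
  then have "word_image G n w = word_image G n (inv\<^bsub>free_group n\<^esub> w)"
    if "group G" for G :: "'g monoid"
    using word_image_endomorphism_subset[OF that assms(1)] assms(2,3) \<sigma>.G.inv_closed
    by (metis subset_antisym)
  then show ?thesis by (simp add: achiral_def)
qed

section \<open>Sign changes of generators and conjugation\<close>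

definition sign_change :: "nat set \<Rightarrow> word \<Rightarrow> word" where
  "sign_change S = map (\<lambda>(i, b). (i, b \<noteq> (i \<in> S)))"

lemma sign_change_involutive: "sign_change S (sign_change S w) = w"
  by (induction w) (auto simp: sign_change_def)

lemma sign_change_UNIV: "sign_change UNIV w = map letter_inv w"
  by (simp add: sign_change_def letter_inv_def case_prod_unfold)

text \<open>Flipping signs commutes with inverting letters, so cancellations occur at the same places
  before and after.\<close>

lemma sign_change_push:
  "sign_change S (push a w) = push (hd (sign_change S [a])) (sign_change S w)"
  by (cases w) (auto simp: sign_change_def letter_inv_def split: prod.splits)

lemma sign_change_foldr_push:
  "sign_change S (foldr push u v) = foldr push (sign_change S u) (sign_change S v)"
  by (induction u) (simp_all add: sign_change_push, simp_all add: sign_change_def)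

lemma reduced_sign_change: "reduced w \<Longrightarrow> reduced (sign_change S w)"
  unfolding reduced_def sign_change_def successively_map
  by (erule successively_mono) (auto simp: letter_inv_def)

lemma sign_change_closed:
  "w \<in> carrier (free_group n) \<Longrightarrow> sign_change S w \<in> carrier (free_group n)"
  by (auto simp: carrier_free_group_iff reduced_sign_change) (auto simp: sign_change_def)

lemma sign_change_hom: "sign_change S \<in> hom (free_group n) (free_group n)"
  by (rule homI, erule sign_change_closed) (simp add: free_group_def sign_change_foldr_push)

lemma sign_change_bij:
  "bij_betw (sign_change S) (carrier (free_group n)) (carrier (free_group n))"
  by (rule bij_betw_byWitness[where f' = "sign_change S"])
    (auto simp: sign_change_involutive sign_change_closed)

lemma sign_change_gen_int_pow:
  assumes "i \<in> {1..n}"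
  shows "sign_change S (gen i [^]\<^bsub>free_group n\<^esub> (m::int))
    = gen i [^]\<^bsub>free_group n\<^esub> (if i \<in> S then - m else m)"
proof -
  interpret \<phi>: group_hom "free_group n" "free_group n" "sign_change S"
    using sign_change_hom group_free_group by (simp add: group_hom_def group_hom_axioms_def)
  have "sign_change S (gen i) = (if i \<in> S then inv\<^bsub>free_group n\<^esub> (gen i) else gen i)"
    using inv_gen[OF assms] by (simp add: sign_change_def gen_def)
  then show ?thesis
    using gen_in_carrier[OF assms] \<phi>.hom_int_pow[of "gen i" m]
    by (simp add: \<phi>.G.int_pow_inv \<phi>.G.int_pow_neg)
qed

lemma (in group) mult_inv_cancel_left:
  assumes "x \<in> carrier G" "y \<in> carrier G"
  shows "x \<otimes> (inv x \<otimes> y) = y" "inv x \<otimes> (x \<otimes> y) = y"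
  using assms by (simp_all add: m_assoc[symmetric])

lemma (in group) conj_hom:
  assumes "c \<in> carrier G"
  shows "(\<lambda>x. c \<otimes> x \<otimes> inv c) \<in> hom G G"
  using assms by (intro homI) (simp_all add: m_assoc mult_inv_cancel_left)

lemma (in group) conj_bij:
  assumes "c \<in> carrier G"
  shows "bij_betw (\<lambda>x. c \<otimes> x \<otimes> inv c) (carrier G) (carrier G)"
  by (rule bij_betw_byWitness[where f' = "\<lambda>x. inv c \<otimes> x \<otimes> c"])
    (use assms in \<open>auto simp: m_assoc mult_inv_cancel_left\<close>)

lemma sign_change_conj_auto:
  assumes "c \<in> carrier (free_group n)"
  shows "(\<lambda>u\<in>carrier (free_group n).
      c \<otimes>\<^bsub>free_group n\<^esub> sign_change S u \<otimes>\<^bsub>free_group n\<^esub> inv\<^bsub>free_group n\<^esub> c)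
    \<in> auto (free_group n)" (is "restrict ?\<sigma> _ \<in> _")
proof -
  interpret F: group "free_group n" by (rule group_free_group)
  have hom: "?\<sigma> \<in> hom (free_group n) (free_group n)"
    using hom_compose[OF sign_change_hom F.conj_hom[OF assms]] by (simp add: comp_def)
  have "bij_betw ?\<sigma> (carrier (free_group n)) (carrier (free_group n))"
    using bij_betw_trans[OF sign_change_bij F.conj_bij[OF assms]] by (simp add: comp_def)
  then have "restrict ?\<sigma> (carrier (free_group n)) \<in> Bij (carrier (free_group n))"
    by (simp add: Bij_def)
  moreover have "restrict ?\<sigma> (carrier (free_group n)) \<in> hom (free_group n) (free_group n)"
    using hom by (simp add: restrict_def)
  ultimately show ?thesis by (simp add: auto_def)
qed

section \<open>Inverting the words\<close>

theorem corollary6: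
  fixes n :: nat and w :: word
  assumes "w \<in> carrier (free_group n)"
    and "palindromic w
      \<or> (n \<ge> 2 \<and> (\<exists>(m1::int) (m2::int).
            w = gen 1 [^]\<^bsub>free_group n\<^esub> m1 \<otimes>\<^bsub>free_group n\<^esub> gen 2 [^]\<^bsub>free_group n\<^esub> m2))
      \<or> (n \<ge> 2 \<and> (\<exists>(m::int) (k::int) (e1::int) (e2::int). (e1 = e2 \<or> e1 = - e2) \<and>
            w = gen 1 [^]\<^bsub>free_group n\<^esub> m \<otimes>\<^bsub>free_group n\<^esub> gen 2 [^]\<^bsub>free_group n\<^esub> e1
              \<otimes>\<^bsub>free_group n\<^esub> gen 1 [^]\<^bsub>free_group n\<^esub> k \<otimes>\<^bsub>free_group n\<^esub> gen 2 [^]\<^bsub>free_group n\<^esub> e2))"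
  shows "(\<exists>\<sigma> \<in> auto (free_group n). \<sigma> w = inv\<^bsub>free_group n\<^esub> w) \<and> achiral TYPE('g) n w"
proof -
  interpret F: group "free_group n" by (rule group_free_group)
  consider (palindrome) "palindromic w"
    | (two_syllables) m1 m2 :: int where "2 \<le> n"
      "w = gen 1 [^]\<^bsub>free_group n\<^esub> m1 \<otimes>\<^bsub>free_group n\<^esub> gen 2 [^]\<^bsub>free_group n\<^esub> m2"
    | (four_syllables) m k e1 e2 :: int where "2 \<le> n" "e1 = e2 \<or> e1 = - e2"
      "w = gen 1 [^]\<^bsub>free_group n\<^esub> m \<otimes>\<^bsub>free_group n\<^esub> gen 2 [^]\<^bsub>free_group n\<^esub> e1
        \<otimes>\<^bsub>free_group n\<^esub> gen 1 [^]\<^bsub>free_group n\<^esub> k \<otimes>\<^bsub>free_group n\<^esub> gen 2 [^]\<^bsub>free_group n\<^esub> e2"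
    using assms(2) by blast
  then have "\<exists>S. \<exists>c\<in>carrier (free_group n).
      c \<otimes>\<^bsub>free_group n\<^esub> sign_change S w \<otimes>\<^bsub>free_group n\<^esub> inv\<^bsub>free_group n\<^esub> c = inv\<^bsub>free_group n\<^esub> w"
  proof cases
    case palindrome
    then have "sign_change UNIV w = inv\<^bsub>free_group n\<^esub> w"
      using inv_free_group[OF assms(1)]
      by (simp add: palindromic_def sign_change_UNIV rev_map)
    then show ?thesis
      using assms(1) by (intro exI[of _ UNIV] bexI[of _ "\<one>\<^bsub>free_group n\<^esub>"]) simp_all
  next
    case two_syllables
    then have gens: "1 \<in> {1..n}" "2 \<in> {1..n}" by auto
    note flip = sign_change_gen_int_pow[OF gens(1)] sign_change_gen_int_pow[OF gens(2)]
    note [simp] = gen_in_carrier[OF gens(1)] gen_in_carrier[OF gens(2)]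
    \<comment> \<open>Rotate the syllable in \<open>x\<^sub>2\<close> to the front.\<close>
    show ?thesis
      by (intro exI[of _ UNIV] bexI[of _ "gen 2 [^]\<^bsub>free_group n\<^esub> (- m2)"])
        (simp_all add: two_syllables(2) hom_mult[OF sign_change_hom] flip
          F.inv_mult_group F.int_pow_neg F.m_assoc del: One_nat_def)
  next
    case four_syllables
    then have gens: "1 \<in> {1..n}" "2 \<in> {1..n}" by auto
    note flip = sign_change_gen_int_pow[OF gens(1)] sign_change_gen_int_pow[OF gens(2)]
    note [simp] = gen_in_carrier[OF gens(1)] gen_in_carrier[OF gens(2)]
    \<comment> \<open>Rotate the first syllable to the end; \<open>x\<^sub>2\<close> keeps its sign unless its exponents agree.\<close>
    define S where "S = (if e1 = e2 then UNIV else {1::nat})"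
    have S: "1 \<in> S" "2 \<in> S \<longleftrightarrow> e1 = e2" by (auto simp: S_def)
    have "gen 1 [^]\<^bsub>free_group n\<^esub> m \<otimes>\<^bsub>free_group n\<^esub> sign_change S w
        \<otimes>\<^bsub>free_group n\<^esub> inv\<^bsub>free_group n\<^esub> (gen 1 [^]\<^bsub>free_group n\<^esub> m) = inv\<^bsub>free_group n\<^esub> w"
      using four_syllables(2)
      by (auto simp: four_syllables(3) hom_mult[OF sign_change_hom] flip S
          F.inv_mult_group F.int_pow_neg F.m_assoc F.mult_inv_cancel_left simp del: One_nat_def)
    then show ?thesis
      using F.int_pow_closed[OF gen_in_carrier[OF gens(1)]] by blast
  qed
  then obtain S c where c: "c \<in> carrier (free_group n)" and inverts:
    "c \<otimes>\<^bsub>free_group n\<^esub> sign_change S w \<otimes>\<^bsub>free_group n\<^esub> inv\<^bsub>free_group n\<^esub> c = inv\<^bsub>free_group n\<^esub> w"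
    by blast
  define \<sigma> where "\<sigma> = (\<lambda>u\<in>carrier (free_group n).
      c \<otimes>\<^bsub>free_group n\<^esub> sign_change S u \<otimes>\<^bsub>free_group n\<^esub> inv\<^bsub>free_group n\<^esub> c)"
  have \<sigma>: "\<sigma> \<in> auto (free_group n)"
    using sign_change_conj_auto[OF c] by (simp add: \<sigma>_def)
  have "\<sigma> w = inv\<^bsub>free_group n\<^esub> w" using assms(1) inverts by (simp add: \<sigma>_def)
  moreover from this have "achiral TYPE('g) n w"
    using achiral_if_endomorphism_inverts[OF _ assms(1)] \<sigma> by (auto simp: auto_def)
  ultimately show ?thesis using \<sigma> by blast
qed

end
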